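(* Let $P_{\Omega,z}$ and $Q_{\Omega,(z,[\gamma])}$ be commuting differential operators, of orders $N$ and $M$, as described in the context, and let $A(\Omega,\lambda)=\sum_{s=-M}^\infty A_s(\Omega)\lambda^{-s}$ be the series with $Q\Psi=A\Psi$. Assume that $N$ is a prime number and that there exists $s\ge -M$, with $N$ and $s$ coprime, such that $A_s(\Omega)\not\equiv0$. Suppose that the arithmetic genus $\varpi(\mathcal{R}_\Omega)$ of the algebraic curve $\mathcal{R}_\Omega$ is smaller than $N$ for any $\Omega\in\mathbb{H}_n^g$. Then all coefficients of $Q_{\Omega,(z,[\gamma])}$ are single-valued functions of $z$.
   Context: **Groups.** $F$ is a totally real number field with $[F:\mathbb{Q}]=g$ and distinct embeddings $\varphi_1,\dots,\varphi_g:F\hookrightarrow\mathbb{R}$. $Sp(n,A)=\{\alpha\in GL(2n,A)\mid {}^t\alpha J\alpha=J\}$, $J=\begin{pmatrix}0&-I_n\\ I_n&0\end{pmatrix}$. $\mathbb{H}_n=\{\Omega\in M_n(\mathbb{C})\mid {}^t\Omega=\Omega,\ \mathrm{Im}(\Omega)>0\}$. $Sp(n,F)$ is embedded in $Sp(n,\mathbb{R})^g$ by $\alpha\mapsto(\alpha^{\varphi_1},\dots,\alpha^{\varphi_g})$ and acts on $\mathbb{H}_n^g$ by $\alpha(\Omega)=(\alpha^{\varphi_1}(\Omega_1),\dots,\alpha^{\varphi_g}(\Omega_g))$, where $\begin{pmatrix}A&B\\C&D\end{pmatrix}(\Omega)=(A\Omega+B)(C\Omega+D)^{-1}$. Put $j_\alpha(\Omega)=\prod_{\nu=1}^g\det(C^{\varphi_\nu}\Omega_\nu+D^{\varphi_\nu})$.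 A congruence subgroup $\Gamma$ of $Sp(n,F)$ is a subgroup containing, with finite index, some $\Gamma(\mathfrak{c})=\{\alpha\in Sp(n,\mathfrak{O}_F)\mid\alpha-I_{2n}\in\mathfrak{c}M(2n,\mathfrak{O}_F)\}$, $\mathfrak{c}$ an ideal of the ring of integers $\mathfrak{O}_F$. **The operators.** $P_{\Omega,z}=\frac{\partial^N}{\partial z^N}+a_2(\Omega,z)\frac{\partial^{N-2}}{\partial z^{N-2}}+\cdots+a_N(\Omega,z)$, where $\Omega\in\mathbb{H}_n^g$, $z\in\mathbb{C}$; $\Omega\mapsto a_l(\Omega,z)$ is holomorphic for generic $z$; for fixed $\Omega$, $z\mapsto a_l(\Omega,z)$ is analytic with at most poles; and $a_l(\alpha(\Omega),z/j_\alpha(\Omega))=j_\alpha(\Omega)^la_l(\Omega,z)$ for $\alpha\in\Gamma$, with $\Gamma\subset Sp(n,F)$ a congruence subgroup. $\mathcal{N}_\Omega\subset\mathbb{C}$ is the union of the pole sets of the $z\mapsto a_l(\Omega,z)$. $\mathfrak{X}_\Omega$ is the universal covering of $\mathbb{C}-\mathcal{N}_\Omega$; with base point $w$, its points are $(z,[\gamma])$, $\gamma$ an arc in $\mathbb{C}-\mathcal{N}_\Omega$ from $w$ to $z$. $Q_{\Omega,(z,[\gamma])}=\sum_{k=0}^Mb_k(\Omega,(z,[\gamma]))\frac{\partial^{M-k}}{\partial z^{M-k}}$ has coefficients locally analytic in $(z,[\gamma])\in\mathfrak{X}_\Omega$ (i.e. possibly multivalued on $\mathbb{C}-\mathcal{N}_\Omega$)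 and commutes with $P_{\Omega,z}$. **Baker–Akhiezer function, eigenvalue, curve.** $\Psi(\Omega,(z,[\gamma]),w,\lambda)=\big(\sum_{s\ge0}\xi_s(\Omega,(z,[\gamma]),w)\lambda^{-s}\big)e^{\lambda(z-w)}$ is the unique formal solution of $P_{\Omega,z}u=\lambda^Nu$ of this form with $\xi_0\equiv1$, $\xi_s(\Omega,(w,[id]),w)=0$ ($s\ge1$). Since $Q$ commutes with $P$, there is a series $A(\Omega,\lambda)=\sum_{s=-M}^\infty A_s(\Omega)\lambda^{-s}$ independent of $(z,[\gamma])$ and $w$ with $Q\Psi=A\Psi$ for generic $\lambda$. With $\lambda_1,\dots,\lambda_N$ the solutions of $\lambda^N=X$, $F_\Omega(X,Y)=\prod_{j=1}^N(Y-A(\Omega,\lambda_j))$ is a polynomial in $X,Y$, and $\mathcal{R}_\Omega$ is the algebraic curve $F_\Omega(X,Y)=0$ (including the point over $X=\infty$ for the projection $(X,Y)\mapsto X$ to $\mathbb{P}^1(\mathbb{C})$). **Arithmetic genus.** If a resolution of singularities $\tilde{\mathcal{R}}\to\mathcal{R}$ of a curve $\mathcal{R}$ is a composition of $l$ blowing ups at singular points of multiplicities $m_1,\dots,m_l$, and $g'$ is the genus of $\mathcal{R}$ (the genus of the non-singular curve $\tilde{\mathcal R}$), then $\varpi(\mathcal{R})=g'+\sum_{\nu=1}^l\frac{m_\nu(m_\nu-1)}{2}$; if $\mathcal{R}$ is non-singular this is its genus. *)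

theory Defs
  imports
    "HOL-Complex_Analysis.Complex_Analysis"
    "HOL-Computational_Algebra.Computational_Algebra"
    "HOL-Algebra.Coset"
begin

section \<open>Totally real fields and the symplectic group\<close>

text \<open>The embeddings are indexed by a finite type \<open>'g\<close>.  Since there are as many distinct real
  embeddings as the degree, the field is totally real and \<open>\<phi>\<close> lists all its embeddings.\<close>

definition totally_real_field :: "('g::finite \<Rightarrow> 'f::field_char_0 \<Rightarrow> real) \<Rightarrow> bool" where
  "totally_real_field \<phi> \<longleftrightarrow>
     (\<exists>B. finite_dimensional_vector_space (\<lambda>(q::rat) (x::'f). of_rat q * x) B \<and> card B = CARD('g)) \<and>
     inj \<phi> \<and>
     (\<forall>\<nu>. \<phi> \<nu> 1 = 1 \<and> (\<forall>x y. \<phi> \<nu> (x + y) = \<phi> \<nu> x + \<phi> \<nu> y \<and> \<phi> \<nu> (x * y) = \<phi> \<nu> x * \<phi> \<nu> y))"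

definition ring_of_integers :: "'f::field_char_0 set" where
  "ring_of_integers = {x. algebraic_int x}"

definition integral_ideal :: "'f::field_char_0 set \<Rightarrow> bool" where
  "integral_ideal \<cc> \<longleftrightarrow> \<cc> \<subseteq> ring_of_integers \<and> 0 \<in> \<cc> \<and> (\<exists>x\<in>\<cc>. x \<noteq> 0) \<and>
     (\<forall>x\<in>\<cc>. \<forall>y\<in>\<cc>. x + y \<in> \<cc>) \<and> (\<forall>r\<in>ring_of_integers. \<forall>x\<in>\<cc>. r * x \<in> \<cc>)"

text \<open>Matrices of size \<open>2n\<close> have index type \<open>'n + 'n\<close>, so that the blocks are selected by
  \<open>Inl\<close> and \<open>Inr\<close>.\<close>

definition J_mat :: "'f::field_char_0^('n::finite + 'n)^('n + 'n)" where
  "J_mat = (\<chi> i j. case (i, j) of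
      (Inl a, Inr b) \<Rightarrow> if a = b then - 1 else 0
    | (Inr a, Inl b) \<Rightarrow> if a = b then 1 else 0
    | _ \<Rightarrow> 0)"

definition entries_in :: "'f set \<Rightarrow> 'f^'m^'m \<Rightarrow> bool" where
  "entries_in R \<alpha> \<longleftrightarrow> (\<forall>i j. \<alpha> $ i $ j \<in> R)"

definition Sp :: "'f::field_char_0 set \<Rightarrow> ('f^('n::finite + 'n)^('n + 'n)) set" where
  "Sp R = {\<alpha>. entries_in R \<alpha> \<and> (\<exists>\<beta>. entries_in R \<beta> \<and> \<alpha> ** \<beta> = mat 1 \<and> \<beta> ** \<alpha> = mat 1) \<and>
              transpose \<alpha> ** J_mat ** \<alpha> = J_mat}"

definition Sp_group :: "('f::field_char_0^('n::finite + 'n)^('n + 'n)) monoid" where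
  "Sp_group = \<lparr>carrier = Sp UNIV, mult = (**), one = mat 1\<rparr>"

definition principal_congruence_subgroup ::
    "'f::field_char_0 set \<Rightarrow> ('f^('n::finite + 'n)^('n + 'n)) set" where
  "principal_congruence_subgroup \<cc> = {\<alpha> \<in> Sp ring_of_integers. entries_in \<cc> (\<alpha> - mat 1)}"

definition congruence_subgroup :: "('f::field_char_0^('n::finite + 'n)^('n + 'n)) set \<Rightarrow> bool" where
  "congruence_subgroup \<Gamma> \<longleftrightarrow> subgroup \<Gamma> Sp_group \<and>
     (\<exists>\<cc>. integral_ideal \<cc> \<and> principal_congruence_subgroup \<cc> \<subseteq> \<Gamma> \<and>
          finite (rcosets\<^bsub>Sp_group\<lparr>carrier := \<Gamma>\<rparr>\<^esub> (principal_congruence_subgroup \<cc>)))"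

section \<open>The product of Siegel upper half spaces\<close>

definition siegel_upper :: "(complex^'n::finite^'n) set" where
  "siegel_upper = {\<Omega>. transpose \<Omega> = \<Omega> \<and>
     (\<forall>x::real^'n. x \<noteq> 0 \<longrightarrow> x \<bullet> ((\<chi> i j. Im (\<Omega> $ i $ j)) *v x) > 0)}"

definition siegel_prod :: "(complex^'n::finite^'n^'g::finite) set" where
  "siegel_prod = {\<Omega>. \<forall>\<nu>. \<Omega> $ \<nu> \<in> siegel_upper}"

definition block :: "('f \<Rightarrow> real) \<Rightarrow> ('n \<Rightarrow> 'n + 'n) \<Rightarrow> ('n \<Rightarrow> 'n + 'n) \<Rightarrow>
    'f^('n::finite + 'n)^('n + 'n) \<Rightarrow> complex^'n^'n" where
  "block \<sigma> r c \<alpha> = (\<chi> i j. complex_of_real (\<sigma> (\<alpha> $ r i $ c j)))"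

definition symp_action :: "('g \<Rightarrow> 'f \<Rightarrow> real) \<Rightarrow> 'f^('n::finite + 'n)^('n + 'n) \<Rightarrow>
    complex^'n^'n^'g::finite \<Rightarrow> complex^'n^'n^'g" where
  "symp_action \<phi> \<alpha> \<Omega> = (\<chi> \<nu>.
     (block (\<phi> \<nu>) Inl Inl \<alpha> ** \<Omega> $ \<nu> + block (\<phi> \<nu>) Inl Inr \<alpha>) **
     matrix_inv (block (\<phi> \<nu>) Inr Inl \<alpha> ** \<Omega> $ \<nu> + block (\<phi> \<nu>) Inr Inr \<alpha>))"

definition automorphy_factor :: "('g \<Rightarrow> 'f \<Rightarrow> real) \<Rightarrow> 'f^('n::finite + 'n)^('n + 'n) \<Rightarrow>
    complex^'n^'n^'g::finite \<Rightarrow> complex" where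
  "automorphy_factor \<phi> \<alpha> \<Omega> =
     (\<Prod>\<nu>\<in>UNIV. det (block (\<phi> \<nu>) Inr Inl \<alpha> ** \<Omega> $ \<nu> + block (\<phi> \<nu>) Inr Inr \<alpha>))"

text \<open>Holomorphy near a point of \<^const>\<open>siegel_prod\<close>, which is open in the space of tuples of
  symmetric matrices only; hence the derivative within that set.  It is determined on symmetric
  directions, and is required to have a complex linear representative.\<close>

definition siegel_holomorphic_at ::
    "(complex^'n::finite^'n^'g::finite \<Rightarrow> complex) \<Rightarrow> complex^'n^'n^'g \<Rightarrow> bool" where
  "siegel_holomorphic_at f \<Omega>\<^sub>0 \<longleftrightarrow> (\<exists>r>0. \<forall>\<Omega> \<in> siegel_prod \<inter> ball \<Omega>\<^sub>0 r. \<exists>D.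
     (f has_derivative D) (at \<Omega> within siegel_prod) \<and>
     (\<forall>c v. D (\<chi> \<nu> i j. c * v $ \<nu> $ i $ j) = c * D v))"

section \<open>The operators \<open>P\<close>\<close>

text \<open>\<open>a l \<Omega> z\<close>, for \<open>l \<in> {2..N}\<close>, is the coefficient of \<open>\<partial>^(N-l)\<close>.\<close>

definition pole_set :: "nat \<Rightarrow> (nat \<Rightarrow> 's \<Rightarrow> complex \<Rightarrow> complex) \<Rightarrow> 's \<Rightarrow> complex set" where
  "pole_set N a \<Omega> = (\<Union>l\<in>{2..N}. {z. is_pole (a l \<Omega>) z})"

text \<open>Since poles move with \<open>\<Omega>\<close>, ``holomorphic in \<open>\<Omega>\<close> for generic \<open>z\<close>'' is read locally in
  \<open>\<Omega>\<close>: around every \<open>\<Omega>\<close>, for all \<open>z\<close> outside a set without accumulation points.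
  Values at poles are irrelevant, and the analyticity clause excludes wrong values at removable
  singularities.\<close>

definition modular_coefficients :: "('g::finite \<Rightarrow> 'f::field_char_0 \<Rightarrow> real) \<Rightarrow>
    ('f^('n::finite + 'n)^('n + 'n)) set \<Rightarrow> nat \<Rightarrow>
    (nat \<Rightarrow> complex^'n^'n^'g \<Rightarrow> complex \<Rightarrow> complex) \<Rightarrow> bool" where
  "modular_coefficients \<phi> \<Gamma> N a \<longleftrightarrow> (\<forall>l\<in>{2..N}.
     (\<forall>\<Omega>\<in>siegel_prod. \<forall>\<^sub>\<approx>z. siegel_holomorphic_at (\<lambda>\<Omega>'. a l \<Omega>' z) \<Omega>) \<and>
     (\<forall>\<Omega>\<in>siegel_prod. a l \<Omega> meromorphic_on UNIV \<and> a l \<Omega> analytic_on {z. \<not> is_pole (a l \<Omega>) z}) \<and>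
     (\<forall>\<alpha>\<in>\<Gamma>. \<forall>\<Omega>\<in>siegel_prod. \<forall>z. \<not> is_pole (a l \<Omega>) z \<longrightarrow>
        a l (symp_action \<phi> \<alpha> \<Omega>) (z / automorphy_factor \<phi> \<alpha> \<Omega>)
          = automorphy_factor \<phi> \<alpha> \<Omega> ^ l * a l \<Omega> z))"

section \<open>The universal covering of a plane domain\<close>

text \<open>A point is a pair of an endpoint and the homotopy class (with fixed endpoints) of an arc
  in \<open>S\<close> from the base point.\<close>

type_synonym cover_point = "complex \<times> (real \<Rightarrow> complex) set"

definition htpy_class :: "complex set \<Rightarrow> (real \<Rightarrow> complex) \<Rightarrow> (real \<Rightarrow> complex) set" where
  "htpy_class S \<gamma> = {\<delta>. homotopic_paths S \<gamma> \<delta>}"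

definition universal_cover :: "complex set \<Rightarrow> complex \<Rightarrow> cover_point set" where
  "universal_cover S w = {(pathfinish \<gamma>, htpy_class S \<gamma>) | \<gamma>.
     path \<gamma> \<and> path_image \<gamma> \<subseteq> S \<and> pathstart \<gamma> = w}"

definition base_lift :: "complex set \<Rightarrow> complex \<Rightarrow> cover_point" where
  "base_lift S w = (w, htpy_class S (linepath w w))"

text \<open>The local section of the covering through \<open>p\<close>: for \<open>z'\<close> in a disc in \<open>S\<close> around the
  endpoint of \<open>p\<close>, continue the arc by the segment to \<open>z'\<close>.  These sections define the complex
  structure, so \<open>z\<close> is a local coordinate.\<close>

definition local_lift :: "complex set \<Rightarrow> cover_point \<Rightarrow> complex \<Rightarrow> cover_point" where
  "local_lift S p z' = (z', \<Union>\<gamma>\<in>snd p. htpy_class S (\<gamma> +++ linepath (fst p) z'))"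

definition cover_analytic :: "complex set \<Rightarrow> complex \<Rightarrow> (cover_point \<Rightarrow> complex) \<Rightarrow> bool" where
  "cover_analytic S w u \<longleftrightarrow>
     (\<forall>p\<in>universal_cover S w. (\<lambda>z'. u (local_lift S p z')) analytic_on {fst p})"

definition cover_deriv :: "complex set \<Rightarrow> (cover_point \<Rightarrow> complex) \<Rightarrow> cover_point \<Rightarrow> complex" where
  "cover_deriv S u p = deriv (\<lambda>z'. u (local_lift S p z')) (fst p)"

definition single_valued_on_cover :: "complex set \<Rightarrow> complex \<Rightarrow> (cover_point \<Rightarrow> complex) \<Rightarrow> bool" where
  "single_valued_on_cover S w u \<longleftrightarrow> (\<exists>f. \<forall>p\<in>universal_cover S w. u p = f (fst p))"

section \<open>Action of the operators\<close>

text \<open>\<open>D\<close> plays the role of \<open>\<partial>/\<partial>z\<close> on \<open>'v\<close>-valued functions on the covering and \<open>\<iota>\<close> embeds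
  the scalars into \<open>'v\<close>.  The instances used are \<open>(id, cover_deriv S)\<close> for analytic functions and
  \<open>(fls_const, ba_deriv S)\<close> for formal solutions.\<close>

definition P_op :: "(complex \<Rightarrow> 'v::comm_ring_1) \<Rightarrow> ((cover_point \<Rightarrow> 'v) \<Rightarrow> cover_point \<Rightarrow> 'v) \<Rightarrow>
    nat \<Rightarrow> (nat \<Rightarrow> complex \<Rightarrow> complex) \<Rightarrow> (cover_point \<Rightarrow> 'v) \<Rightarrow> cover_point \<Rightarrow> 'v" where
  "P_op \<iota> D N a u p = (D ^^ N) u p + (\<Sum>l=2..N. \<iota> (a l (fst p)) * (D ^^ (N - l)) u p)"

definition Q_op :: "(complex \<Rightarrow> 'v::comm_ring_1) \<Rightarrow> ((cover_point \<Rightarrow> 'v) \<Rightarrow> cover_point \<Rightarrow> 'v) \<Rightarrow>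
    nat \<Rightarrow> (nat \<Rightarrow> cover_point \<Rightarrow> complex) \<Rightarrow> (cover_point \<Rightarrow> 'v) \<Rightarrow> cover_point \<Rightarrow> 'v" where
  "Q_op \<iota> D M b u p = (\<Sum>k=0..M. \<iota> (b k p) * (D ^^ (M - k)) u p)"

definition operators_commute :: "complex set \<Rightarrow> complex \<Rightarrow> nat \<Rightarrow> (nat \<Rightarrow> complex \<Rightarrow> complex) \<Rightarrow>
    nat \<Rightarrow> (nat \<Rightarrow> cover_point \<Rightarrow> complex) \<Rightarrow> bool" where
  "operators_commute S w N a M b \<longleftrightarrow>
     (\<forall>u. cover_analytic S w u \<longrightarrow> (\<forall>p\<in>universal_cover S w.
        P_op id (cover_deriv S) N a (Q_op id (cover_deriv S) M b u) p =
        Q_op id (cover_deriv S) M b (P_op id (cover_deriv S) N a u) p))"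

section \<open>The Baker--Akhiezer function\<close>

text \<open>Formal series in descending powers of \<open>\<lambda>\<close> are formal Laurent series in the variable
  \<open>\<lambda>\<^sup>-\<^sup>1\<close>; so \<open>fls_X_inv\<close> is \<open>\<lambda>\<close>, and \<open>fls_nth A s\<close> is the coefficient of \<open>\<lambda>^(-s)\<close>.
  A formal function \<open>u exp(\<lambda>(z-w))\<close> is represented by its prefactor \<open>u\<close>, and \<open>\<partial>/\<partial>z\<close> acts on the
  prefactor as \<open>u \<mapsto> \<partial>u/\<partial>z + \<lambda>u\<close>, with \<open>\<partial>u/\<partial>z\<close> taken coefficientwise.\<close>

definition ba_deriv :: "complex set \<Rightarrow> (cover_point \<Rightarrow> complex fls) \<Rightarrow> cover_point \<Rightarrow> complex fls" where
  "ba_deriv S u p = Abs_fls (\<lambda>m. cover_deriv S (\<lambda>q. fls_nth (u q) m) p) + fls_X_inv * u p"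

definition ba_series :: "(nat \<Rightarrow> cover_point \<Rightarrow> complex) \<Rightarrow> cover_point \<Rightarrow> complex fls" where
  "ba_series \<xi> p = fps_to_fls (Abs_fps (\<lambda>s. \<xi> s p))"

definition baker_akhiezer :: "complex set \<Rightarrow> complex \<Rightarrow> nat \<Rightarrow> (nat \<Rightarrow> complex \<Rightarrow> complex) \<Rightarrow>
    (nat \<Rightarrow> cover_point \<Rightarrow> complex) \<Rightarrow> bool" where
  "baker_akhiezer S w N a \<xi> \<longleftrightarrow>
     (\<forall>s. cover_analytic S w (\<xi> s)) \<and>
     (\<forall>p\<in>universal_cover S w. \<xi> 0 p = 1) \<and>
     (\<forall>s\<ge>1. \<xi> s (base_lift S w) = 0) \<and>
     (\<forall>p\<in>universal_cover S w.
        P_op fls_const (ba_deriv S) N a (ba_series \<xi>) p = fls_X_inv ^ N * ba_series \<xi> p)"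

definition eigenvalue_series :: "complex set \<Rightarrow> complex \<Rightarrow> nat \<Rightarrow> (nat \<Rightarrow> cover_point \<Rightarrow> complex) \<Rightarrow>
    (nat \<Rightarrow> cover_point \<Rightarrow> complex) \<Rightarrow> complex fls \<Rightarrow> bool" where
  "eigenvalue_series S w M b \<xi> A \<longleftrightarrow>
     (\<forall>s < - int M. fls_nth A s = 0) \<and>
     (\<forall>p\<in>universal_cover S w.
        Q_op fls_const (ba_deriv S) M b (ba_series \<xi>) p = A * ba_series \<xi> p)"

section \<open>Plane curves\<close>

text \<open>A polynomial in \<open>X\<close>, \<open>Y\<close> is a polynomial in \<open>Y\<close> over the polynomials in \<open>X\<close>.\<close>

definition eval2 :: "(complex \<Rightarrow> 'a::comm_ring_1) \<Rightarrow> complex poly poly \<Rightarrow> 'a \<Rightarrow> 'a \<Rightarrow> 'a" where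
  "eval2 \<iota> F x y = poly (map_poly (\<lambda>c. poly (map_poly \<iota> c) x) F) y"

definition zero_locus :: "complex poly poly \<Rightarrow> (complex \<times> complex) set" where
  "zero_locus F = {(x, y). eval2 id F x y = 0}"

text \<open>\<open>A(c\<lambda>)\<close>\<close>

definition scale_lambda :: "complex \<Rightarrow> complex fls \<Rightarrow> complex fls" where
  "scale_lambda c A = Abs_fls (\<lambda>s. c powi (- s) * fls_nth A s)"

text \<open>\<open>F(\<lambda>^N, Y) = \<Prod>\<^sub>j (Y - A(\<zeta>^j \<lambda>))\<close> with \<open>\<zeta> = exp(2\<pi>\<i>/N)\<close>; the \<open>\<zeta>^j \<lambda>\<close> are the
  \<open>N\<close>-th roots of \<open>X = \<lambda>^N\<close>.\<close>

definition spectral_polynomial :: "nat \<Rightarrow> complex fls \<Rightarrow> complex poly poly \<Rightarrow> bool" where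
  "spectral_polynomial N A F \<longleftrightarrow>
     map_poly (\<lambda>c. poly (map_poly fls_const c) (fls_X_inv ^ N)) F =
     (\<Prod>j<N. [:- scale_lambda (cis (2 * pi * real j / real N)) A, 1:])"

subsection \<open>Multiplicities and resolution by blowing up\<close>

abbreviation const2 :: "complex \<Rightarrow> complex poly poly" where
  "const2 k \<equiv> [:[:k:]:]"

abbreviation X2 :: "complex poly poly" where
  "X2 \<equiv> [:[:0, 1:]:]"

abbreviation Y2 :: "complex poly poly" where
  "Y2 \<equiv> [:0, 1:]"

definition multiplicity_at :: "complex poly poly \<Rightarrow> complex \<times> complex \<Rightarrow> nat" where
  "multiplicity_at G = (\<lambda>(a, b). LEAST m. \<exists>i j. i + j = m \<and>
     coeff (coeff (eval2 const2 G (X2 + const2 a) (Y2 + const2 b)) j) i \<noteq> 0)"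

text \<open>Strict transforms in the two charts \<open>(x, y) \<mapsto> (a + x, b + x y)\<close> and
  \<open>(x, y) \<mapsto> (a + x y, b + y)\<close> of the blowing up at \<open>(a, b)\<close>; the divisions are exact.\<close>

definition blowup1 :: "complex poly poly \<Rightarrow> complex \<times> complex \<Rightarrow> complex poly poly" where
  "blowup1 G = (\<lambda>(a, b). eval2 const2 G (X2 + const2 a) (X2 * Y2 + const2 b)
     div X2 ^ multiplicity_at G (a, b))"

definition blowup2 :: "complex poly poly \<Rightarrow> complex \<times> complex \<Rightarrow> complex poly poly" where
  "blowup2 G = (\<lambda>(a, b). eval2 const2 G (X2 * Y2 + const2 a) (Y2 + const2 b)
     div Y2 ^ multiplicity_at G (a, b))"

text \<open>An iterated blowing up of the plane is covered by affine charts.  A chart is recorded as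
  \<open>(G, U)\<close>, with \<open>G\<close> the local equation of the strict transform of the curve and \<open>U\<close> a set of
  points of the chart such that every point of the surface lies in \<open>U\<close> for exactly one chart: a
  point that is blown up is removed from its chart, and the new exceptional line consists of the
  points \<open>(0, t)\<close> of the first new chart and the origin of the second one.\<close>

type_synonym chart = "complex poly poly \<times> (complex \<times> complex) set"

inductive resolution :: "chart list \<Rightarrow> nat list \<Rightarrow> bool" where
  nonsingular: "(\<And>G U p. (G, U) \<in> set cs \<Longrightarrow> p \<in> U \<Longrightarrow> multiplicity_at G p \<le> 1) \<Longrightarrow> resolution cs []"
| blow_up: "p \<in> U \<Longrightarrow> m = multiplicity_at G p \<Longrightarrow> m \<ge> 2 \<Longrightarrow>
    resolution (cs @ [(G, U - {p}), (blowup1 G p, {0} \<times> UNIV), (blowup2 G p, {(0, 0)})] @ cs') ms \<Longrightarrow>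
    resolution (cs @ [(G, U)] @ cs') (m # ms)"

subsection \<open>Genus of a function field\<close>

text \<open>Function fields of one variable over the complex numbers, as subfields of the field of
  formal Laurent series.  The places are the points of the nonsingular complete model; all of them
  have degree one.\<close>

definition is_place :: "complex fls set \<Rightarrow> complex fls set \<Rightarrow> bool" where
  "is_place K R \<longleftrightarrow> range fls_const \<subseteq> R \<and> R \<subset> K \<and>
     (\<forall>f\<in>R. \<forall>h\<in>R. f - h \<in> R \<and> f * h \<in> R) \<and> (\<forall>f\<in>K. f \<in> R \<or> inverse f \<in> R)"

definition place_units :: "complex fls set \<Rightarrow> complex fls set" where
  "place_units R = {f \<in> R. f \<noteq> 0 \<and> inverse f \<in> R}"

definition uniformizer :: "complex fls set \<Rightarrow> complex fls \<Rightarrow> bool" where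
  "uniformizer R t \<longleftrightarrow> t \<in> R \<and> (\<lambda>h. t * h) ` R = R - place_units R"

definition place_ord :: "complex fls set \<Rightarrow> complex fls \<Rightarrow> int" where
  "place_ord R f = (THE k. \<exists>t v. uniformizer R t \<and> v \<in> place_units R \<and> f = t powi k * v)"

definition is_divisor :: "complex fls set \<Rightarrow> (complex fls set \<Rightarrow> int) \<Rightarrow> bool" where
  "is_divisor K D \<longleftrightarrow> finite {R. D R \<noteq> 0} \<and> (\<forall>R. D R \<noteq> 0 \<longrightarrow> is_place K R)"

definition divisor_degree :: "(complex fls set \<Rightarrow> int) \<Rightarrow> int" where
  "divisor_degree D = (\<Sum>R | D R \<noteq> 0. D R)"

definition riemann_roch_space :: "complex fls set \<Rightarrow> (complex fls set \<Rightarrow> int) \<Rightarrow> complex fls set" where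
  "riemann_roch_space K D =
     {f \<in> K. f = 0 \<or> (\<forall>R. is_place K R \<longrightarrow> place_ord R f \<ge> - D R)}"

definition riemann_defect :: "complex fls set \<Rightarrow> (complex fls set \<Rightarrow> int) \<Rightarrow> int" where
  "riemann_defect K D = divisor_degree D + 1 -
     int (vector_space.dim (\<lambda>c f. fls_const c * f) (riemann_roch_space K D))"

text \<open>The genus is the maximum of \<open>deg D + 1 - dim L(D)\<close> over all divisors (Riemann).\<close>

definition function_field_genus :: "complex fls set \<Rightarrow> nat \<Rightarrow> bool" where
  "function_field_genus K g \<longleftrightarrow>
     (\<exists>D. is_divisor K D \<and> riemann_defect K D = int g) \<and>
     (\<forall>D. is_divisor K D \<longrightarrow> riemann_defect K D \<le> int g)"

text \<open>\<open>(x, y)\<close> is a generic point of the irreducible curve \<open>G = 0\<close> if the polynomials vanishing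
  at it are the multiples of \<open>G\<close>; then \<open>\<complex>(x, y)\<close> is (isomorphic to) its function field.  A generic
  point in Laurent series exists: take the expansion at a nonsingular point.\<close>

definition generic_point :: "complex poly poly \<Rightarrow> complex fls \<Rightarrow> complex fls \<Rightarrow> bool" where
  "generic_point G x y \<longleftrightarrow> (\<forall>H. eval2 fls_const H x y = 0 \<longleftrightarrow> G dvd H)"

definition generated_field :: "complex fls \<Rightarrow> complex fls \<Rightarrow> complex fls set" where
  "generated_field x y =
     {eval2 fls_const p x y / eval2 fls_const q x y | p q. eval2 fls_const q x y \<noteq> 0}"

definition curve_genus :: "complex poly poly \<Rightarrow> nat \<Rightarrow> bool" where
  "curve_genus G g \<longleftrightarrow>
     (\<exists>x y. generic_point G x y \<and> function_field_genus (generated_field x y) g)"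

subsection \<open>Arithmetic genus\<close>

text \<open>\<open>C\<close> is an affine plane curve, regarded as a reduced variety and completed by nonsingular
  points at infinity.  For the spectral curve this adds the single point \<open>\<lambda> = \<infinity>\<close> over
  \<open>X = \<infinity>\<close>, at which \<open>\<lambda>\<^sup>-\<^sup>1\<close> is a local parameter; hence only affine points are blown up.\<close>

definition arithmetic_genus :: "(complex \<times> complex) set \<Rightarrow> nat \<Rightarrow> bool" where
  "arithmetic_genus C \<pi> \<longleftrightarrow> (\<exists>G g' ms. squarefree G \<and> zero_locus G = C \<and>
     curve_genus G g' \<and> resolution [(G, UNIV)] ms \<and>
     \<pi> = g' + (\<Sum>m\<leftarrow>ms. m * (m - 1) div 2))"

end

theory Submission
  imports Defs
begin

text \<open>Since \<open>P\<close> has single-valued coefficients, the values \<open>u\<close>, \<open>v\<close> of the Baker--Akhiezer function at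
  two points of the covering over the same \<open>z\<close> are both formal solutions of \<open>P y = \<lambda>^N y\<close> near \<open>z\<close>.
  Comparing leading coefficients of \<open>P y = \<lambda>^N y\<close> shows that \<open>v = K u\<close> with a series \<open>K\<close> in
  \<open>\<lambda>\<^sup>-\<^sup>1\<close> that does not depend on \<open>z\<close>.  As the eigenvalue \<open>A\<close> is the same at both points, the two
  branches of \<open>Q\<close> act in the same way on \<open>u\<close>.  An operator in \<open>z\<close> is determined by its action on
  \<open>u = (1 + \<dots>) exp(\<lambda>z)\<close>, so the branches coincide.\<close>

section \<open>Formal solutions\<close>

lemma fls_mult_nth_lowest:
  fixes f g :: "'a::field fls"
  assumes f: "\<And>m. m < i \<Longrightarrow> fls_nth f m = 0" and g: "\<And>m. m < j \<Longrightarrow> fls_nth g m = 0"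
  shows "fls_nth (f * g) (i + j) = fls_nth f i * fls_nth g j"
proof (cases "f = 0 \<or> g = 0")
  case False
  then have ij: "i \<le> fls_subdegree f" "j \<le> fls_subdegree g"
    using f g by (auto intro: fls_subdegree_geI)
  show ?thesis
  proof (cases "i = fls_subdegree f \<and> j = fls_subdegree g")
    case False
    with ij have "i < fls_subdegree f \<or> j < fls_subdegree g" by auto
    then have "i + j < fls_subdegree f + fls_subdegree g" "fls_nth f i * fls_nth g j = 0"
      using ij by auto
    then show ?thesis by (simp add: fls_times_nth_eq0)
  qed simp
qed auto

lemma fls_mult_nth_eq_0:
  fixes f g :: "'a::field fls"
  assumes f: "\<And>m. m < i \<Longrightarrow> fls_nth f m = 0" and g: "\<And>m. m < j \<Longrightarrow> fls_nth g m = 0"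
    and m: "m < i + j"
  shows "fls_nth (f * g) m = 0"
proof -
  \<comment> \<open>Since \<open>m - i < j\<close>, the index \<open>m - i\<close> is again a valid
    lower bound for \<open>g\<close>, but one whose own coefficient vanishes.\<close>
  have "fls_nth (f * g) (i + (m - i)) = fls_nth f i * fls_nth g (m - i)"
    using assms by (intro fls_mult_nth_lowest) auto
  then show ?thesis using g[of "m - i"] m by simp
qed

text \<open>A sequence \<open>y\<close> stands for the formal function \<open>(\<Sum>m. y m * \<lambda>^(-m)) exp(\<lambda>z)\<close>.\<close>

definition twisted_deriv :: "(int \<Rightarrow> 'a::comm_ring_1 fps) \<Rightarrow> int \<Rightarrow> 'a fps" where
  "twisted_deriv y m = fps_deriv (y m) + y (m + 1)"

text \<open>This is the coefficient of \<open>\<lambda>^(-m)\<close> in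
  \<open>P y = \<lambda>^N y\<close>, with \<open>\<alpha> l\<close> the Taylor series of the
  coefficients of \<open>P\<close>; multiplication by \<open>\<lambda>^N\<close> becomes the shift
  by \<open>N\<close>.\<close>

definition formal_solution :: "nat \<Rightarrow> (nat \<Rightarrow> 'a::comm_ring_1 fps) \<Rightarrow> (int \<Rightarrow> 'a fps) \<Rightarrow> bool" where
  "formal_solution N \<alpha> y \<longleftrightarrow> (\<forall>m. (twisted_deriv ^^ N) y m +
     (\<Sum>l=2..N. \<alpha> l * (twisted_deriv ^^ (N - l)) y m) = y (m + int N))"

lemma twisted_deriv_Suc:
  "(twisted_deriv ^^ Suc j) y m = fps_deriv ((twisted_deriv ^^ j) y m) + (twisted_deriv ^^ j) y (m + 1)"
  by (simp add: twisted_deriv_def)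

lemma twisted_deriv_iter_eq_0:
  assumes "\<And>m. m < s \<Longrightarrow> y m = 0" "m < s - int j"
  shows "(twisted_deriv ^^ j) y m = 0"
  using assms(2) by (induction j arbitrary: m) (auto simp: assms(1) twisted_deriv_Suc simp del: funpow.simps(2))

lemma twisted_deriv_iter_leading:
  assumes "\<And>m. m < s \<Longrightarrow> y m = 0"
  shows "(twisted_deriv ^^ j) y (s - int j) = y s"
proof (induction j)
  case (Suc j)
  have "(twisted_deriv ^^ j) y (s - int (Suc j)) = 0"
    using assms by (rule twisted_deriv_iter_eq_0) auto
  moreover have "s - int (Suc j) + 1 = s - int j" by simp
  ultimately show ?case using Suc by (simp only: twisted_deriv_Suc) simp
qed simp

text \<open>These are the first two terms of the binomial expansion of
  \<open>(\<partial> + \<lambda>)^j\<close>, namely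
  \<open>\<lambda>^j + j \<lambda>^(j-1) \<partial>\<close>.\<close>

lemma twisted_deriv_iter_subleading:
  assumes "\<And>m. m < s \<Longrightarrow> y m = 0"
  shows "(twisted_deriv ^^ j) y (s - int j + 1) = y (s + 1) + of_nat j * fps_deriv (y s)"
proof (induction j)
  case (Suc j)
  have "(twisted_deriv ^^ Suc j) y (s - int (Suc j) + 1) =
      fps_deriv ((twisted_deriv ^^ j) y (s - int j)) + (twisted_deriv ^^ j) y (s - int j + 1)"
    using twisted_deriv_Suc[of j y "s - int (Suc j) + 1"] by simp
  also have "\<dots> = fps_deriv (y s) + (y (s + 1) + of_nat j * fps_deriv (y s))"
    using Suc twisted_deriv_iter_leading[of s y j, OF assms] by simp
  finally show ?case by (simp add: algebra_simps)
qed simp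

text \<open>The sequence on the left is \<open>y - c \<lambda>^(-s) u\<close>. The factor
  \<open>c \<lambda>^(-s)\<close> is independent of \<open>z\<close>, so it commutes with
  \<open>\<partial> + \<lambda>\<close>.\<close>

lemma twisted_deriv_iter_diff:
  "(twisted_deriv ^^ j) (\<lambda>m. y m - fps_const c * u (m - s)) m =
   (twisted_deriv ^^ j) y m - fps_const c * (twisted_deriv ^^ j) u (m - s)"
proof (induction j arbitrary: m)
  case (Suc j)
  have shift: "m + 1 - s = m - s + 1" by simp
  show ?case unfolding twisted_deriv_Suc Suc shift by (simp add: right_diff_distrib distrib_left)
qed simp

lemma formal_solution_diff:
  assumes "formal_solution N \<alpha> y" "formal_solution N \<alpha> u"
  shows "formal_solution N \<alpha> (\<lambda>m. y m - fps_const c * u (m - s))"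
proof -
  have *: "(twisted_deriv ^^ N) y m + (\<Sum>l=2..N. \<alpha> l * (twisted_deriv ^^ (N - l)) y m) = y (m + int N)"
    "(twisted_deriv ^^ N) u m + (\<Sum>l=2..N. \<alpha> l * (twisted_deriv ^^ (N - l)) u m) = u (m + int N)" for m
    using assms by (auto simp: formal_solution_def)
  have sum: "(\<Sum>l=2..N. \<alpha> l * ((twisted_deriv ^^ (N - l)) y m - fps_const c * (twisted_deriv ^^ (N - l)) u (m - s))) =
    (\<Sum>l=2..N. \<alpha> l * (twisted_deriv ^^ (N - l)) y m) -
    fps_const c * (\<Sum>l=2..N. \<alpha> l * (twisted_deriv ^^ (N - l)) u (m - s))" for m
    by (simp add: sum_distrib_left sum_subtractf right_diff_distrib mult.left_commute)
  have shift: "m + int N - s = m - s + int N" for m by simp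
  show ?thesis
    unfolding formal_solution_def twisted_deriv_iter_diff sum shift *[symmetric]
    by (simp add: distrib_left)
qed

text \<open>\<open>P\<close> has no term of order \<open>N - 1\<close>, so the equation at index
  \<open>s - N + 1\<close> reads \<open>y (s + 1) + N * y' = y (s + 1)\<close> with
  \<open>y'\<close> the derivative of \<open>y s\<close>. In characteristic 0 this forces
  \<open>y' = 0\<close>.\<close>

lemma formal_solution_leading_constant:
  fixes y :: "int \<Rightarrow> 'a::field_char_0 fps"
  assumes "formal_solution N \<alpha> y" "N > 0" and y: "\<And>m. m < s \<Longrightarrow> y m = 0"
  shows "y s = fps_const (fps_nth (y s) 0)"
proof -
  \<comment> \<open>An iterate of order \<open>N - l\<close> can first be nonzero at index
    \<open>s - N + l\<close>, hence not before \<open>s - N + 2\<close>.\<close>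
  have "(twisted_deriv ^^ (N - l)) y (s - int N + 1) = 0" if "l \<in> {2..N}" for l
    using y by (rule twisted_deriv_iter_eq_0) (use that in auto)
  then have "(\<Sum>l=2..N. \<alpha> l * (twisted_deriv ^^ (N - l)) y (s - int N + 1)) = 0"
    by (intro sum.neutral) auto
  moreover have "(twisted_deriv ^^ N) y (s - int N + 1) +
      (\<Sum>l=2..N. \<alpha> l * (twisted_deriv ^^ (N - l)) y (s - int N + 1)) = y (s - int N + 1 + int N)"
    using assms(1) unfolding formal_solution_def by blast
  ultimately have "y (s + 1) + of_nat N * fps_deriv (y s) = y (s + 1)"
    using twisted_deriv_iter_subleading[of s y N, OF y] by (simp del: fps_deriv_eq_0_iff)
  then have "of_nat N * fps_deriv (y s) = 0" by (simp del: fps_deriv_eq_0_iff)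
  then have "fps_deriv (y s) = 0" using \<open>N > 0\<close> by (simp del: fps_deriv_eq_0_iff)
  then show ?thesis by (rule fps_deriv_eq_0_iff[THEN iffD1])
qed

text \<open>The statement is a truncated form of \<open>v = K u\<close>.  In the proof, \<open>y\<close> is the formal solution
  \<open>v - K u\<close>, whose lowest coefficient is constant and can be absorbed into \<open>K\<close>.\<close>

lemma formal_solution_proportional:
  fixes u v :: "int \<Rightarrow> 'a::field_char_0 fps" and U V :: "nat \<Rightarrow> 'a fls"
  assumes "N > 0" and u: "formal_solution N \<alpha> u" "\<And>m. m < 0 \<Longrightarrow> u m = 0" "u 0 = 1"
    and v: "formal_solution N \<alpha> v" "\<And>m. m < 0 \<Longrightarrow> v m = 0" "v 0 = 1"
    and U: "\<And>j m. fls_nth (U j) m = fps_nth ((twisted_deriv ^^ j) u m) 0"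
    and V: "\<And>j m. fls_nth (V j) m = fps_nth ((twisted_deriv ^^ j) v m) 0"
  obtains K where "fls_nth K 0 = 1" "\<And>m. m < 0 \<Longrightarrow> fls_nth K m = 0"
    "\<And>j m. m < int s - int j \<Longrightarrow> fls_nth (V j - K * U j) m = 0"
proof -
  have "\<exists>K y. fls_nth K 0 = 1 \<and> (\<forall>m<0. fls_nth K m = 0) \<and> formal_solution N \<alpha> y \<and>
      (\<forall>m<int s + 1. y m = 0) \<and>
      (\<forall>j m. fps_nth ((twisted_deriv ^^ j) y m) 0 = fls_nth (V j - K * U j) m)"
  proof (induction s)
    case 0
    \<comment> \<open>Start with \<open>K = 1\<close>: the leading coefficients of \<open>u\<close>
      and \<open>v\<close> are both 1 and cancel.\<close>
    define y where "y = (\<lambda>m. v m - fps_const 1 * u (m - 0))"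
    have "formal_solution N \<alpha> y" unfolding y_def by (intro formal_solution_diff u v)
    moreover have "y m = 0" if "m < 1" for m
      using that u v unfolding y_def by (cases "m = 0") auto
    moreover have "fps_nth ((twisted_deriv ^^ j) y m) 0 = fls_nth (V j - 1 * U j) m" for j m
      unfolding y_def twisted_deriv_iter_diff by (simp add: U V)
    ultimately show ?case by (intro exI[of _ 1] exI[of _ y]) auto
  next
    case (Suc s)
    then obtain K y where K: "fls_nth K 0 = 1" "\<And>m. m < 0 \<Longrightarrow> fls_nth K m = 0"
      and y: "formal_solution N \<alpha> y" "\<And>m. m < int s + 1 \<Longrightarrow> y m = 0"
        "\<And>j m. fps_nth ((twisted_deriv ^^ j) y m) 0 = fls_nth (V j - K * U j) m" by auto
    define t where "t = int s + 1"
    define c where "c = fps_nth (y t) 0"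
    define y' where "y' = (\<lambda>m. y m - fps_const c * u (m - t))"
    \<comment> \<open>\<open>fls_X_intpow t\<close> is \<open>\<lambda>^(-t)\<close>. As
      \<open>t \<ge> 1\<close>, the correction leaves the coefficients of \<open>K\<close> at
      indices up to 0 alone.\<close>
    define K' where "K' = K + fls_const c * fls_X_intpow t"
    have c: "y t = fps_const c"
      unfolding c_def t_def using y(1) \<open>N > 0\<close> y(2) by (rule formal_solution_leading_constant)
    have "formal_solution N \<alpha> y'" unfolding y'_def by (intro formal_solution_diff u y)
    moreover have "y' m = 0" if "m < int (Suc s) + 1" for m
      using that u c y(2)[of m] unfolding y'_def by (cases "m = t") (auto simp: t_def)
    moreover have "fps_nth ((twisted_deriv ^^ j) y' m) 0 = fls_nth (V j - K' * U j) m" for j m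
    proof -
      have "K' * U j = K * U j + fls_const c * fls_shift (- t) (U j)"
        by (simp only: K'_def distrib_right mult.assoc fls_X_intpow_times_conv_shift(1))
      then show ?thesis
        unfolding y'_def twisted_deriv_iter_diff by (simp add: U y(3))
    qed
    moreover have "fls_nth K' m = fls_nth K m" if "m \<le> 0" for m
      using that by (simp add: K'_def t_def)
    ultimately show ?case using K by (intro exI[of _ K'] exI[of _ y']) auto
  qed
  then obtain K y where K: "fls_nth K 0 = 1" "\<And>m. m < 0 \<Longrightarrow> fls_nth K m = 0"
    and y: "\<And>m. m < int s + 1 \<Longrightarrow> y m = 0"
      "\<And>j m. fps_nth ((twisted_deriv ^^ j) y m) 0 = fls_nth (V j - K * U j) m" by auto
  have "fls_nth (V j - K * U j) m = 0" if "m < int s - int j" for j m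
    unfolding y(2)[symmetric] using twisted_deriv_iter_eq_0[of "int s" y m j] y(1) that by simp
  with K that show ?thesis by blast
qed

section \<open>Recovering an operator from its action on one formal solution\<close>

text \<open>\<open>U j\<close> begins with \<open>\<lambda>^j\<close> with coefficient 1, so the
  coefficients of \<open>\<lambda>^M, ..., \<lambda>^0\<close> form a unitriangular linear system
  for the \<open>d k\<close>.\<close>

lemma triangular_coefficients_eq_0:
  fixes U :: "nat \<Rightarrow> 'a::field fls" and d :: "nat \<Rightarrow> 'a"
  assumes W: "\<And>m. m \<le> 0 \<Longrightarrow> fls_nth (\<Sum>k=0..M. fls_const (d k) * U (M - k)) m = 0"
    and U: "\<And>j m. m < - int j \<Longrightarrow> fls_nth (U j) m = 0" "\<And>j. fls_nth (U j) (- int j) = 1"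
  shows "k \<le> M \<Longrightarrow> d k = 0"
proof (induction k rule: less_induct)
  case (less k)
  have "d i * fls_nth (U (M - i)) (- int (M - k)) = (if i = k then d k else 0)" if "i \<le> M" for i
  proof (cases i k rule: linorder_cases)
    case less' : less
    then show ?thesis using less by simp
  next
    case greater
    then show ?thesis using that by (simp add: U(1) of_nat_diff)
  qed (simp add: U(2))
  then have "fls_nth (\<Sum>i=0..M. fls_const (d i) * U (M - i)) (- int (M - k)) =
      (\<Sum>i=0..M. if i = k then d k else 0)"
    by (simp add: fls_nth_sum)
  then show ?case using W[of "- int (M - k)"] less.prems by simp
qed

text \<open>Let \<open>W\<close> be the difference of the two operators applied to \<open>u\<close>.
  Up to the truncation errors \<open>E j = V j - K * U j\<close>, both sides of the second
  eigenvalue equation are \<open>K\<close> times expressions in \<open>U\<close>; so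
  \<open>K * W\<close>, and then \<open>W\<close>, has only negative powers of
  \<open>\<lambda>\<close>.\<close>

lemma operator_determined_by_eigenvalue:
  fixes u v :: "int \<Rightarrow> 'a::field_char_0 fps" and U V :: "nat \<Rightarrow> 'a fls"
  assumes "N > 0" and u: "formal_solution N \<alpha> u" "\<And>m. m < 0 \<Longrightarrow> u m = 0" "u 0 = 1"
    and v: "formal_solution N \<alpha> v" "\<And>m. m < 0 \<Longrightarrow> v m = 0" "v 0 = 1"
    and U: "\<And>j m. fls_nth (U j) m = fps_nth ((twisted_deriv ^^ j) u m) 0"
    and V: "\<And>j m. fls_nth (V j) m = fps_nth ((twisted_deriv ^^ j) v m) 0"
    and A: "\<And>m. m < - int M \<Longrightarrow> fls_nth A m = 0"
    and AU: "(\<Sum>k=0..M. fls_const (\<beta> k) * U (M - k)) = A * U 0"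
    and AV: "(\<Sum>k=0..M. fls_const (\<beta>' k) * V (M - k)) = A * V 0"
    and "k \<le> M"
  shows "\<beta> k = \<beta>' k"
proof -
  \<comment> \<open>The precision \<open>Suc M\<close> is chosen so that no error reaches index 0:
    \<open>A * E 0\<close> starts at \<open>- M + (M + 1) = 1\<close> or later, and
    \<open>E (M - k)\<close> at \<open>k + 1\<close> or later.\<close>
  obtain K where K: "fls_nth K 0 = 1" "\<And>m. m < 0 \<Longrightarrow> fls_nth K m = 0"
    and V': "\<And>j m. m < int (Suc M) - int j \<Longrightarrow> fls_nth (V j - K * U j) m = 0"
    using formal_solution_proportional[of N \<alpha> u v U V "Suc M"] assms by blast
  define E where "E j = V j - K * U j" for j
  define W where "W = (\<Sum>k=0..M. fls_const (\<beta>' k - \<beta> k) * U (M - k))"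
  have "W = (\<Sum>k=0..M. fls_const (\<beta>' k) * U (M - k)) - A * U 0"
    by (simp add: W_def AU[symmetric] sum_subtractf[symmetric] algebra_simps
        flip: fls_minus_const)
  then have "K * W = K * (\<Sum>k=0..M. fls_const (\<beta>' k) * U (M - k)) - A * (K * U 0)"
    by (simp add: right_diff_distrib mult.left_commute)
  also have "K * (\<Sum>k=0..M. fls_const (\<beta>' k) * U (M - k)) =
      (\<Sum>k=0..M. fls_const (\<beta>' k) * V (M - k)) - (\<Sum>k=0..M. fls_const (\<beta>' k) * E (M - k))"
    by (simp add: E_def sum_distrib_left sum_subtractf[symmetric] algebra_simps)
  finally have KW: "K * W = A * E 0 - (\<Sum>k=0..M. fls_const (\<beta>' k) * E (M - k))"
    by (simp add: AV E_def algebra_simps)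
  have "fls_nth (A * E 0) m = 0" if "m \<le> 0" for m
    by (rule fls_mult_nth_eq_0[of "- int M" _ "int (Suc M)"]) (use A V' that in \<open>auto simp: E_def\<close>)
  moreover have "fls_nth (E (M - k)) m = 0" if "m \<le> 0" "k \<le> M" for m k
    unfolding E_def using that by (intro V') auto
  ultimately have KW0: "fls_nth (K * W) m = 0" if "m \<le> 0" for m
    using that by (simp add: KW fls_nth_sum)
  have W0: "fls_nth W m = 0" if "m \<le> 0" for m
  proof (cases "W = 0")
    case False
    \<comment> \<open>As \<open>K\<close> begins with 1, the lowest coefficient of \<open>W\<close>
      survives in \<open>K * W\<close>, so it cannot sit at an index up to 0.\<close>
    have "fls_nth (K * W) (0 + fls_subdegree W) = fls_nth K 0 * fls_nth W (fls_subdegree W)"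
      by (rule fls_mult_nth_lowest) (use K in auto)
    then have "\<not> fls_subdegree W \<le> 0"
      using False K(1) KW0[of "fls_subdegree W"] by auto
    then show ?thesis using that by simp
  qed simp
  have "\<beta>' k - \<beta> k = 0"
  proof (rule triangular_coefficients_eq_0[where U = U])
    show "fls_nth (U j) m = 0" if "m < - int j" for j m
      using twisted_deriv_iter_eq_0[of 0 u m j] u(2) that by (simp add: U)
    show "fls_nth (U j) (- int j) = 1" for j
      using twisted_deriv_iter_leading[of 0 u j] u(2,3) by (simp add: U)
  qed (use W0 \<open>k \<le> M\<close> in \<open>auto simp: W_def\<close>)
  then show ?thesis by simp
qed

section \<open>Local sections of the covering\<close>

lemma htpy_class_eq: "homotopic_paths S \<gamma> \<delta> \<Longrightarrow> htpy_class S \<gamma> = htpy_class S \<delta>"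
  unfolding htpy_class_def
  using homotopic_paths_trans[of S \<gamma> \<delta>] homotopic_paths_trans[of S \<delta> \<gamma>] homotopic_paths_sym[of S \<gamma> \<delta>]
  by blast

text \<open>Appending the same segment to homotopic arcs gives homotopic arcs, so the union in
  \<open>local_lift\<close> collapses to a single class.\<close>

lemma local_lift_htpy_class:
  assumes "path \<gamma>" "path_image \<gamma> \<subseteq> S" "closed_segment (pathfinish \<gamma>) z \<subseteq> S"
  shows "local_lift S (pathfinish \<gamma>, htpy_class S \<gamma>) z =
    (z, htpy_class S (\<gamma> +++ linepath (pathfinish \<gamma>) z))"
proof -
  have "htpy_class S (\<delta> +++ linepath (pathfinish \<gamma>) z) =
      htpy_class S (\<gamma> +++ linepath (pathfinish \<gamma>) z)" if "\<delta> \<in> htpy_class S \<gamma>" for \<delta>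
  proof -
    have "homotopic_paths S \<gamma> \<delta>" using that by (simp add: htpy_class_def)
    then show ?thesis
      by (intro htpy_class_eq homotopic_paths_join homotopic_paths_sym[of S \<gamma>])
        (use assms homotopic_paths_imp_pathfinish[of S \<gamma> \<delta>] in auto)
  qed
  moreover have "\<gamma> \<in> htpy_class S \<gamma>" using assms by (simp add: htpy_class_def)
  ultimately have "(\<Union>\<delta>\<in>htpy_class S \<gamma>. htpy_class S (\<delta> +++ linepath (pathfinish \<gamma>) z)) =
      htpy_class S (\<gamma> +++ linepath (pathfinish \<gamma>) z)"
    by (intro SUP_eq_const) blast+
  then show ?thesis by (simp only: local_lift_def fst_conv snd_conv)
qed

lemma local_lift_self:
  assumes "p \<in> universal_cover S w"
  shows "local_lift S p (fst p) = p"
proof -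
  obtain \<gamma> where \<gamma>: "p = (pathfinish \<gamma>, htpy_class S \<gamma>)" "path \<gamma>" "path_image \<gamma> \<subseteq> S"
    using assms by (auto simp: universal_cover_def)
  then have "pathfinish \<gamma> \<in> S" by auto
  then show ?thesis
    using \<gamma> by (auto simp: local_lift_htpy_class intro!: htpy_class_eq homotopic_paths_rid)
qed

lemma local_lift_in_universal_cover:
  assumes "p \<in> universal_cover S w" "closed_segment (fst p) z \<subseteq> S"
  shows "local_lift S p z \<in> universal_cover S w"
proof -
  obtain \<gamma> where \<gamma>: "p = (pathfinish \<gamma>, htpy_class S \<gamma>)" "path \<gamma>" "path_image \<gamma> \<subseteq> S"
      "pathstart \<gamma> = w"
    using assms(1) by (auto simp: universal_cover_def)
  have "(z, htpy_class S (\<gamma> +++ linepath (pathfinish \<gamma>) z)) \<in> universal_cover S w"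
    unfolding universal_cover_def
    by (rule CollectI, rule exI[of _ "\<gamma> +++ linepath (pathfinish \<gamma>) z"])
      (use \<gamma> assms(2) in \<open>auto simp: path_image_join\<close>)
  then show ?thesis using \<gamma> assms(2) by (simp add: local_lift_htpy_class)
qed

text \<open>Inside the convex set \<open>B\<close> two successive segments are homotopic to the
  direct one. Hence sections through nearby points of one sheet coincide.\<close>

lemma local_lift_local_lift:
  assumes "p \<in> universal_cover S w" "convex B" "B \<subseteq> S" "fst p \<in> B" "z \<in> B" "z' \<in> B"
  shows "local_lift S (local_lift S p z) z' = local_lift S p z'"
proof -
  obtain \<gamma> where \<gamma>: "p = (pathfinish \<gamma>, htpy_class S \<gamma>)" "path \<gamma>" "path_image \<gamma> \<subseteq> S"
    using assms(1) by (auto simp: universal_cover_def)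
  define x where "x = pathfinish \<gamma>"
  have x: "x \<in> B" using \<gamma> assms by (simp add: x_def)
  have seg: "closed_segment s t \<subseteq> B" if "s \<in> B" "t \<in> B" for s t
    using that assms(2) by (simp add: closed_segment_subset)
  have segS: "closed_segment s t \<subseteq> S" if "s \<in> B" "t \<in> B" for s t
    using seg[OF that] assms(3) by blast
  let ?\<gamma>' = "\<gamma> +++ linepath x z"
  have \<gamma>': "path ?\<gamma>'" "path_image ?\<gamma>' \<subseteq> S" "pathfinish ?\<gamma>' = z"
    using \<gamma> segS x assms by (auto simp: x_def path_image_join)
  have "homotopic_paths B (linepath x z +++ linepath z z') (linepath x z')"
    using convex_imp_simply_connected[OF assms(2)] seg x assms(5,6)
    unfolding simply_connected_eq_homotopic_paths
    by (auto simp: path_image_join)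
  then have "homotopic_paths S (linepath x z +++ linepath z z') (linepath x z')"
    using assms(3) by (rule homotopic_paths_subset)
  then have "homotopic_paths S (\<gamma> +++ (linepath x z +++ linepath z z')) (\<gamma> +++ linepath x z')"
    by (intro homotopic_paths_join) (use \<gamma> x_def in auto)
  moreover have "homotopic_paths S (\<gamma> +++ (linepath x z +++ linepath z z')) (?\<gamma>' +++ linepath z z')"
    by (intro homotopic_paths_assoc) (use \<gamma> segS x assms in \<open>auto simp: x_def\<close>)
  ultimately have "htpy_class S (?\<gamma>' +++ linepath z z') = htpy_class S (\<gamma> +++ linepath x z')"
    by (metis htpy_class_eq)
  moreover have "local_lift S (z, htpy_class S ?\<gamma>') z' = (z', htpy_class S (?\<gamma>' +++ linepath z z'))"
    using local_lift_htpy_class[OF \<gamma>'(1,2), of z'] \<gamma>'(3) segS assms(5,6) by simp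
  ultimately show ?thesis
    using \<gamma> segS x assms by (simp add: local_lift_htpy_class x_def)
qed

lemma fst_local_lift [simp]: "fst (local_lift S p z) = z"
  by (simp add: local_lift_def)

text \<open>Near \<open>p\<close> the derivative on the covering becomes the ordinary derivative in
  the coordinate \<open>x = z - fst p\<close>, so power series methods apply.\<close>

lemma eventually_local_lift:
  assumes "open S" "p \<in> universal_cover S w"
  shows "\<forall>\<^sub>F x in nhds 0. local_lift S p (fst p + x) \<in> universal_cover S w" (is ?cover)
    and "\<forall>\<^sub>F x in nhds 0. cover_deriv S f (local_lift S p (fst p + x)) =
      deriv (\<lambda>x. f (local_lift S p (fst p + x))) x" (is ?deriv)
proof -
  define c where "c = fst p"
  have "c \<in> S" using assms(2) by (auto simp: universal_cover_def c_def)
  then obtain r where r: "r > 0" "ball c r \<subseteq> S" using assms(1) openE by blast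
  have "\<forall>\<^sub>F x in nhds 0. x \<in> ball (0::complex) r"
    using r by (intro eventually_nhds_in_open) auto
  then have "\<forall>\<^sub>F x in nhds 0. local_lift S p (fst p + x) \<in> universal_cover S w \<and>
    cover_deriv S f (local_lift S p (fst p + x)) =
      deriv (\<lambda>x. f (local_lift S p (fst p + x))) x"
  proof eventually_elim
    case (elim x)
    then have x: "c + x \<in> ball c r" by (simp add: dist_norm)
    have "closed_segment c (c + x) \<subseteq> ball c r"
      using x r by (intro closed_segment_subset) auto
    then have "local_lift S p (c + x) \<in> universal_cover S w"
      using assms(2) r by (intro local_lift_in_universal_cover) (auto simp: c_def)
    \<comment> \<open>\<open>cover_deriv\<close> uses the section through the moved point; on the
      disc this agrees with the section through \<open>p\<close>.\<close>
    moreover have "cover_deriv S f (local_lift S p (c + x)) = deriv (\<lambda>z. f (local_lift S p z)) (c + x)"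
    proof -
      have "\<forall>\<^sub>F z in nhds (c + x). z \<in> ball c r"
        using x by (intro eventually_nhds_in_open) auto
      then have "\<forall>\<^sub>F z in nhds (c + x).
          f (local_lift S (local_lift S p (c + x)) z) = f (local_lift S p z)"
        by eventually_elim
          (use local_lift_local_lift[OF assms(2) convex_ball r(2)] r x in \<open>simp add: c_def\<close>)
      then show ?thesis unfolding cover_deriv_def by (simp add: deriv_cong_ev)
    qed
    moreover have "deriv (\<lambda>z. f (local_lift S p z)) (c + x) =
        deriv (\<lambda>x. f (local_lift S p (c + x))) x"
      using deriv_shift_0[of "\<lambda>z. f (local_lift S p z)" "c + x"]
        deriv_shift_0[of "\<lambda>x. f (local_lift S p (c + x))" x]
      by (simp add: o_def add.assoc)
    ultimately show ?case by (simp add: c_def)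
  qed
  then show ?cover ?deriv by (auto elim: eventually_mono)
qed

section \<open>Taylor expansion of the Baker--Akhiezer function\<close>

text \<open>Both claims are proved together: \<open>Abs_fls\<close> in \<open>ba_deriv\<close> has
  the intended coefficients once they vanish below some index, and the first claim supplies this
  bound for the second.\<close>

lemma ba_deriv_iter_nth_eq_0:
  "m < - int j \<Longrightarrow> fls_nth ((ba_deriv S ^^ j) (ba_series \<xi>) p) m = 0"
  and ba_deriv_iter_nth_Suc:
  "fls_nth ((ba_deriv S ^^ Suc j) (ba_series \<xi>) p) m =
    cover_deriv S (\<lambda>q. fls_nth ((ba_deriv S ^^ j) (ba_series \<xi>) q) m) p +
    fls_nth ((ba_deriv S ^^ j) (ba_series \<xi>) p) (m + 1)"
proof -
  have step: "fls_nth (ba_deriv S u p) m = cover_deriv S (\<lambda>q. fls_nth (u q) m) p + fls_nth (u p) (m + 1)"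
    if "\<And>q m. m < n \<Longrightarrow> fls_nth (u q) m = 0" for u :: "cover_point \<Rightarrow> complex fls" and n p m
  proof -
    have "\<exists>n. \<forall>m<n. cover_deriv S (\<lambda>q. fls_nth (u q) m) p = 0"
      using that by (intro exI[of _ n]) (auto simp: cover_deriv_def)
    then show ?thesis
      by (simp add: ba_deriv_def nth_Abs_fls_ex_lower_bound fls_X_inv_times_conv_shift)
  qed
  have *: "m < - int j \<Longrightarrow> fls_nth ((ba_deriv S ^^ j) (ba_series \<xi>) p) m = 0" for j p m
  proof (induction j arbitrary: p m)
    case (Suc j)
    then show ?case
      using step[of "- int j" "(ba_deriv S ^^ j) (ba_series \<xi>)" p m] by (simp add: cover_deriv_def)
  qed (simp add: ba_series_def)
  then show "m < - int j \<Longrightarrow> fls_nth ((ba_deriv S ^^ j) (ba_series \<xi>) p) m = 0" .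
  show "fls_nth ((ba_deriv S ^^ Suc j) (ba_series \<xi>) p) m =
    cover_deriv S (\<lambda>q. fls_nth ((ba_deriv S ^^ j) (ba_series \<xi>) q) m) p +
    fls_nth ((ba_deriv S ^^ j) (ba_series \<xi>) p) (m + 1)"
    using step[of "- int j", OF *] by simp
qed

definition ba_expansion :: "complex set \<Rightarrow> (nat \<Rightarrow> cover_point \<Rightarrow> complex) \<Rightarrow> cover_point \<Rightarrow>
    int \<Rightarrow> complex fps" where
  "ba_expansion S \<xi> p m = fps_expansion (\<lambda>z. fls_nth (ba_series \<xi> (local_lift S p z)) m) (fst p)"

text \<open>Taylor expansion along the section turns \<open>ba_deriv\<close> into
  \<open>twisted_deriv\<close>: the derivative acts on each coefficient, and the factor
  \<open>\<lambda>\<close> shifts the index by one.\<close>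

lemma ba_deriv_iter_expansion:
  assumes "open S" "p \<in> universal_cover S w" "\<And>s. cover_analytic S w (\<xi> s)"
  shows "(\<lambda>x. fls_nth ((ba_deriv S ^^ j) (ba_series \<xi>) (local_lift S p (fst p + x))) m)
    has_fps_expansion (twisted_deriv ^^ j) (ba_expansion S \<xi> p) m"
proof (induction j arbitrary: m)
  case 0
  have "(\<lambda>z. fls_nth (ba_series \<xi> (local_lift S p z)) m) analytic_on {fst p}"
  proof (cases "m < 0")
    case False
    then have "(\<lambda>z. \<xi> (nat m) (local_lift S p z)) analytic_on {fst p}"
      using assms(2,3) unfolding cover_analytic_def by blast
    with False show ?thesis by (simp add: ba_series_def)
  qed (simp add: ba_series_def)
  from analytic_at_imp_has_fps_expansion[OF this] show ?case by (simp add: ba_expansion_def)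
next
  case (Suc j)
  let ?f = "\<lambda>m q. fls_nth ((ba_deriv S ^^ j) (ba_series \<xi>) q) m"
  have "(\<lambda>x. deriv (\<lambda>x. ?f m (local_lift S p (fst p + x))) x +
        ?f (m + 1) (local_lift S p (fst p + x)))
      has_fps_expansion (twisted_deriv ^^ Suc j) (ba_expansion S \<xi> p) m"
    unfolding twisted_deriv_Suc
    by (intro has_fps_expansion_add has_fps_expansion_deriv Suc)
  moreover have "\<forall>\<^sub>F x in nhds 0. deriv (\<lambda>x. ?f m (local_lift S p (fst p + x))) x +
        ?f (m + 1) (local_lift S p (fst p + x)) =
      fls_nth ((ba_deriv S ^^ Suc j) (ba_series \<xi>) (local_lift S p (fst p + x))) m"
    using eventually_local_lift(2)[OF assms(1,2), of "?f m"]
    by eventually_elim (simp only: ba_deriv_iter_nth_Suc)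
  ultimately show ?case by (simp only: has_fps_expansion_cong)
qed

text \<open>The coefficients of the resulting equation are expanded at \<open>fst p\<close>, so they
  are the same for all points of the covering over one \<open>z\<close>.\<close>

lemma ba_expansion_formal_solution:
  assumes "open S" "p \<in> universal_cover S w" "baker_akhiezer S w N a \<xi>"
    and a: "\<And>l. l \<in> {2..N} \<Longrightarrow> a l analytic_on {fst p}"
  shows "formal_solution N (\<lambda>l. fps_expansion (a l) (fst p)) (ba_expansion S \<xi> p)"
  unfolding formal_solution_def
proof
  fix m
  have \<xi>: "\<And>s. cover_analytic S w (\<xi> s)" using assms(3) by (simp add: baker_akhiezer_def)
  note exp = ba_deriv_iter_expansion[OF assms(1,2) \<xi>]
  let ?u = "ba_expansion S \<xi> p"
  let ?f = "\<lambda>j m x. fls_nth ((ba_deriv S ^^ j) (ba_series \<xi>) (local_lift S p (fst p + x))) m"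
  have "(\<lambda>x. ?f N m x + (\<Sum>l=2..N. a l (fst p + x) * ?f (N - l) m x)) has_fps_expansion
     (twisted_deriv ^^ N) ?u m +
       (\<Sum>l=2..N. fps_expansion (a l) (fst p) * (twisted_deriv ^^ (N - l)) ?u m)"
    by (intro has_fps_expansion_add has_fps_expansion_sum has_fps_expansion_mult exp
        analytic_at_imp_has_fps_expansion a)
  moreover have "\<forall>\<^sub>F x in nhds 0.
      ?f N m x + (\<Sum>l=2..N. a l (fst p + x) * ?f (N - l) m x) = ?f 0 (m + int N) x"
    using eventually_local_lift(1)[OF assms(1,2)]
  proof eventually_elim
    case (elim x)
    then have "P_op fls_const (ba_deriv S) N a (ba_series \<xi>) (local_lift S p (fst p + x)) =
        fls_X_inv ^ N * ba_series \<xi> (local_lift S p (fst p + x))"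
      using assms(3) by (simp add: baker_akhiezer_def)
    \<comment> \<open>Compare coefficients of \<open>\<lambda>^(-m)\<close>; the factor
      \<open>fls_X_inv ^ N\<close> moves the right side to index \<open>m + N\<close>.\<close>
    from arg_cong[OF this, of "\<lambda>f. fls_nth f m"] show ?case
      by (simp add: P_op_def fls_nth_sum fls_X_inv_power_times_conv_shift)
  qed
  ultimately have "?f 0 (m + int N) has_fps_expansion (twisted_deriv ^^ N) ?u m +
       (\<Sum>l=2..N. fps_expansion (a l) (fst p) * (twisted_deriv ^^ (N - l)) ?u m)"
    by (simp only: has_fps_expansion_cong)
  moreover have "?f 0 (m + int N) has_fps_expansion ?u (m + int N)"
    using exp[of 0] by simp
  ultimately show "(twisted_deriv ^^ N) ?u m +
       (\<Sum>l=2..N. fps_expansion (a l) (fst p) * (twisted_deriv ^^ (N - l)) ?u m) = ?u (m + int N)"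
    by (rule fps_expansion_unique_complex)
qed

lemma ba_expansion_leading:
  assumes "open S" "p \<in> universal_cover S w" "baker_akhiezer S w N a \<xi>"
  shows "m < 0 \<Longrightarrow> ba_expansion S \<xi> p m = 0" "ba_expansion S \<xi> p 0 = 1"
proof -
  have \<xi>: "\<And>s. cover_analytic S w (\<xi> s)" using assms(3) by (simp add: baker_akhiezer_def)
  have exp: "(\<lambda>x. fls_nth (ba_series \<xi> (local_lift S p (fst p + x))) m)
      has_fps_expansion ba_expansion S \<xi> p m" for m
    using ba_deriv_iter_expansion[OF assms(1,2) \<xi>, where j = 0] by simp
  show "ba_expansion S \<xi> p m = 0" if "m < 0"
    by (rule fps_expansion_unique_complex[OF exp[of m]]) (use that in \<open>simp add: ba_series_def\<close>)
  have "\<forall>\<^sub>F x in nhds 0. fls_nth (ba_series \<xi> (local_lift S p (fst p + x))) 0 = 1"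
    using eventually_local_lift(1)[OF assms(1,2)]
    by eventually_elim (use assms(3) in \<open>simp add: ba_series_def baker_akhiezer_def\<close>)
  then have "(\<lambda>_. 1) has_fps_expansion ba_expansion S \<xi> p 0"
    using exp[of 0] by (simp only: has_fps_expansion_cong)
  then show "ba_expansion S \<xi> p 0 = 1"
    by (rule fps_expansion_unique_complex) (rule has_fps_expansion_1)
qed

text \<open>Evaluate the expansion at its centre, where the section returns \<open>p\<close>. This
  links the series \<open>U j\<close> and \<open>V j\<close> of the algebraic lemmas to the
  Baker--Akhiezer function.\<close>

lemma ba_deriv_iter_nth_conv_expansion:
  assumes "open S" "p \<in> universal_cover S w" "\<And>s. cover_analytic S w (\<xi> s)"
  shows "fls_nth ((ba_deriv S ^^ j) (ba_series \<xi>) p) m =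
    fps_nth ((twisted_deriv ^^ j) (ba_expansion S \<xi> p) m) 0"
  using has_fps_expansion_imp_0_eq_fps_nth_0[OF ba_deriv_iter_expansion[OF assms]]
    local_lift_self[OF assms(2)] by simp

section \<open>Single-valuedness of the coefficients\<close>

lemma commuting_operator_single_valued:
  assumes "open S" "N > 0" and a: "\<And>l. l \<in> {2..N} \<Longrightarrow> a l analytic_on S"
    and ba: "baker_akhiezer S w N a \<xi>" and A: "eigenvalue_series S w M b \<xi> A" and "k \<le> M"
  shows "single_valued_on_cover S w (b k)"
proof -
  have \<xi>: "\<And>s. cover_analytic S w (\<xi> s)" using ba by (simp add: baker_akhiezer_def)
  have "b k p = b k q"
    if pq: "p \<in> universal_cover S w" "q \<in> universal_cover S w" "fst p = fst q" for p q
  proof -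
    have "fst p \<in> S" using pq(1) by (auto simp: universal_cover_def)
    then have ap: "a l analytic_on {fst p}" if "l \<in> {2..N}" for l
      using a[OF that] analytic_on_subset[of "a l" S "{fst p}"] by simp
    show ?thesis
    proof (rule operator_determined_by_eigenvalue[OF \<open>N > 0\<close>])
      show "formal_solution N (\<lambda>l. fps_expansion (a l) (fst p)) (ba_expansion S \<xi> p)"
        by (rule ba_expansion_formal_solution[OF assms(1) pq(1) ba ap])
      show "formal_solution N (\<lambda>l. fps_expansion (a l) (fst p)) (ba_expansion S \<xi> q)"
        using ba_expansion_formal_solution[OF assms(1) pq(2) ba] ap pq(3) by simp
      \<comment> \<open>One series \<open>A\<close> serves both points, since the eigenvalue does
        not depend on the point of the covering.\<close>
      show "(\<Sum>k=0..M. fls_const (b k p) * (ba_deriv S ^^ (M - k)) (ba_series \<xi>) p) =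
          A * (ba_deriv S ^^ 0) (ba_series \<xi>) p"
        "(\<Sum>k=0..M. fls_const (b k q) * (ba_deriv S ^^ (M - k)) (ba_series \<xi>) q) =
          A * (ba_deriv S ^^ 0) (ba_series \<xi>) q"
        using A pq by (auto simp: eigenvalue_series_def Q_op_def)
      show "fls_nth A m = 0" if "m < - int M" for m
        using A that by (simp add: eigenvalue_series_def)
    qed (fact ba_expansion_leading[OF assms(1) pq(1) ba] ba_expansion_leading[OF assms(1) pq(2) ba]
        ba_deriv_iter_nth_conv_expansion[OF assms(1) pq(1) \<xi>]
        ba_deriv_iter_nth_conv_expansion[OF assms(1) pq(2) \<xi>] \<open>k \<le> M\<close>)+
  qed
  \<comment> \<open>Choosing one point in each fibre defines the required function of
    \<open>z\<close>.\<close>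
  then have "b k p = b k (SOME q. q \<in> universal_cover S w \<and> fst q = fst p)"
    if "p \<in> universal_cover S w" for p
    using that someI[of "\<lambda>q. q \<in> universal_cover S w \<and> fst q = fst p" p] by metis
  then show ?thesis unfolding single_valued_on_cover_def
    by (intro exI[of _ "\<lambda>z. b k (SOME q. q \<in> universal_cover S w \<and> fst q = z)"]) blast
qed

text \<open>Analyticity extends to holomorphy on an open superset \<open>T\<close> of the non-poles.
  No point of \<open>T\<close> is a pole, so \<open>T\<close> is exactly the set of
  non-poles.\<close>

lemma open_Compl_pole_set:
  assumes "\<And>l. l \<in> {2..N} \<Longrightarrow> a l \<Omega> analytic_on {z. \<not> is_pole (a l \<Omega>) z}"
  shows "open (- pole_set N a \<Omega>)"
proof -
  have "open {z. \<not> is_pole (a l \<Omega>) z}" if l: "l \<in> {2..N}" for l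
  proof -
    obtain T where T: "open T" "{z. \<not> is_pole (a l \<Omega>) z} \<subseteq> T" "a l \<Omega> holomorphic_on T"
      using assms[OF l] unfolding analytic_on_holomorphic by blast
    then have "{z. \<not> is_pole (a l \<Omega>) z} = T" using not_is_pole_holomorphic by blast
    with T show ?thesis by simp
  qed
  moreover have "- pole_set N a \<Omega> = (\<Inter>l\<in>{2..N}. {z. \<not> is_pole (a l \<Omega>) z})"
    by (auto simp: pole_set_def)
  ultimately show ?thesis by (metis open_INT finite_atLeastAtMost)
qed

theorem theorem2p8:
  fixes \<phi> :: "'g::finite \<Rightarrow> 'f::field_char_0 \<Rightarrow> real"
    and \<Gamma> :: "('f^('n::finite + 'n)^('n + 'n)) set"
    and N M :: nat
    and a :: "nat \<Rightarrow> complex^'n^'n^'g \<Rightarrow> complex \<Rightarrow> complex"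
    and w :: "complex^'n^'n^'g \<Rightarrow> complex"
    and b :: "nat \<Rightarrow> complex^'n^'n^'g \<Rightarrow> cover_point \<Rightarrow> complex"
    and \<xi> :: "complex^'n^'n^'g \<Rightarrow> nat \<Rightarrow> cover_point \<Rightarrow> complex"
    and A :: "complex^'n^'n^'g \<Rightarrow> complex fls"
    and F :: "complex^'n^'n^'g \<Rightarrow> complex poly poly"
  defines "S \<equiv> \<lambda>\<Omega>. - pole_set N a \<Omega>"
  assumes field: "totally_real_field \<phi>"
    and group: "congruence_subgroup \<Gamma>"
    and P: "modular_coefficients \<phi> \<Gamma> N a"
    and base: "\<And>\<Omega>. \<Omega> \<in> siegel_prod \<Longrightarrow> w \<Omega> \<in> S \<Omega>"
    and Q_analytic: "\<And>\<Omega> k. \<Omega> \<in> siegel_prod \<Longrightarrow> k \<le> M \<Longrightarrow> cover_analytic (S \<Omega>) (w \<Omega>) (b k \<Omega>)"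
    and Q_order: "\<exists>\<Omega>\<in>siegel_prod. \<exists>p\<in>universal_cover (S \<Omega>) (w \<Omega>). b 0 \<Omega> p \<noteq> 0"
    and commute: "\<And>\<Omega>. \<Omega> \<in> siegel_prod \<Longrightarrow>
          operators_commute (S \<Omega>) (w \<Omega>) N (\<lambda>l. a l \<Omega>) M (\<lambda>k. b k \<Omega>)"
    and Psi: "\<And>\<Omega>. \<Omega> \<in> siegel_prod \<Longrightarrow> baker_akhiezer (S \<Omega>) (w \<Omega>) N (\<lambda>l. a l \<Omega>) (\<xi> \<Omega>)"
    and eigen: "\<And>\<Omega>. \<Omega> \<in> siegel_prod \<Longrightarrow>
          eigenvalue_series (S \<Omega>) (w \<Omega>) M (\<lambda>k. b k \<Omega>) (\<xi> \<Omega>) (A \<Omega>)"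
    and F: "\<And>\<Omega>. \<Omega> \<in> siegel_prod \<Longrightarrow> spectral_polynomial N (A \<Omega>) (F \<Omega>)"
    and N_prime: "prime N"
    and coprime: "\<exists>s \<ge> - int M. coprime (int N) s \<and> (\<exists>\<Omega>\<in>siegel_prod. fls_nth (A \<Omega>) s \<noteq> 0)"
    and genus: "\<And>\<Omega>. \<Omega> \<in> siegel_prod \<Longrightarrow> \<exists>\<pi> < N. arithmetic_genus (zero_locus (F \<Omega>)) \<pi>"
  shows "\<forall>\<Omega>\<in>siegel_prod. \<forall>k\<le>M. single_valued_on_cover (S \<Omega>) (w \<Omega>) (b k \<Omega>)"
proof (intro ballI allI impI)
  fix \<Omega> :: "complex^'n^'n^'g" and k
  assume \<Omega>: "\<Omega> \<in> siegel_prod" and k: "k \<le> M"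
  have a: "a l \<Omega> analytic_on {z. \<not> is_pole (a l \<Omega>) z}" if "l \<in> {2..N}" for l
    using P \<Omega> that by (auto simp: modular_coefficients_def)
  have "open (S \<Omega>)" unfolding S_def using a by (rule open_Compl_pole_set)
  moreover have "N > 0" using N_prime by (rule prime_gt_0_nat)
  moreover have "a l \<Omega> analytic_on S \<Omega>" if "l \<in> {2..N}" for l
    using a[OF that] by (rule analytic_on_subset) (use that in \<open>auto simp: S_def pole_set_def\<close>)
  ultimately show "single_valued_on_cover (S \<Omega>) (w \<Omega>) (b k \<Omega>)"
    using Psi[OF \<Omega>] eigen[OF \<Omega>] k by (rule commuting_operator_single_valued)
qed

end
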